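(* Let $$M(t,x)=M_0+\sum_{j=1}^N\frac{A_j(t)}{x-x_j(t)}+\sum_{j=1}^N\frac{A_j^*(t)}{x-\bar x_j(t)}$$ be a rational function with simple poles, where $A_j(t)=s_j(t)\cdot\boldsymbol\sigma$ and $A_j(t)=E_j(t)HF_j(t)$, with $$e_j=\left(\sqrt{-s_{j,1}+is_{j,2}},\ \sqrt{s_{j,1}+is_{j,2}}\right),\qquad \xi_j=\left(\sqrt{s_{j,1}+is_{j,2}},\ -\sqrt{-s_{j,1}+is_{j,2}}\right),$$ $E_j=\operatorname{diag}(e_j)$, $F_j=\operatorname{diag}(\xi_j)$. Then the time evolution equation of the spins, $$\partial_tA_j(t)=\sum_{k\ne j}\frac{[A_j(t),A_k(t)]}{(x_j(t)-x_k(t))^2},\qquad j=1,\dots,N,$$ can be rewritten equivalently as the time evolution equation of the half-spins $$\dot E_j(t)=\sum_{l\ne j}\frac{(\xi_j\cdot e_l)\,E_l}{(x_j-x_l)^2},\qquad \dot F_j(t)=\sum_{l\ne j}\frac{(\xi_j\cdot e_l)\,F_l}{(x_j-x_l)^2},\qquad j=1,\dots,N.$$ Additionally, when these evolution equations hold, with $$B_{j,k}=(1-\delta_{j,k})\frac{\xi_j\cdot e_k}{(x_j-x_k)^2},\qquad \dot U(t)=B(t)U(t),\quad U(0)=I_N,$$ we have $$\mathcal E(t)T=[U(t)]\,\mathcal E(0)T,\qquad \mathcal F(t)T=[U(t)]\,\mathcal F(0)T.$$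
   Context: $\sigma_1,\sigma_2,\sigma_3$ are the Pauli matrices and for $s\in\mathbb{C}^3$, $s\cdot\boldsymbol\sigma=\begin{pmatrix}s_3&s_1-is_2\\ s_1+is_2&-s_3\end{pmatrix}$. $M_0$ is a constant $2\times2$ matrix, $s_j(t)\in\mathbb{C}^3\setminus\{0\}$ with $A_j(t)^2=0$ (i.e. $s_j\cdot s_j=0$), the $x_j(t)\in\mathbb{C}$ are pairwise distinct with $\operatorname{Im}x_j(t)>0$, and $t$ ranges over an interval containing $0$; $s_j,x_j$ are continuously differentiable in $t$. $[A,A']=AA'-A'A$ for two $2\times2$ matrices. $H=\begin{pmatrix}1&1\\1&1\end{pmatrix}$. The square roots, written $e_j=(\alpha_j,\beta_j)$, $\xi_j=(\beta_j,-\alpha_j)$, are chosen differentiable in $t$ and with $\alpha_j\beta_j=s_{j,3}$, so that indeed $A_j=E_jHF_j$. For $u,v\in\mathbb{C}^2$, $u\cdot v=u_1v_1+u_2v_2$ (no conjugation). $\mathcal E(t)=\operatorname{diag}(E_1(t),\dots,E_N(t))$ and $\mathcal F(t)=\operatorname{diag}(F_1(t),\dots,F_N(t))$ are block-diagonal $2N\times2N$ matrices with $2\times2$ blocks; $T\in\mathbb{C}^{2N\times2}$ is the column of $N$ blocks $I_{2\times2}$. For $U\in\mathbb{C}^{N\times N}$, $[U]\in\mathbb{C}^{2N\times2N}$ is the doubled matrix whose $(j,k)$ block is $U_{j,k}I_{2\times2}$. *)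

theory Defs
  imports "HOL-Analysis.Analysis"
begin

text \<open>
  One-sided derivatives are used at endpoints of \<open>I\<close>. The library predicate
  \<^const>\<open>C1_differentiable_on\<close> demands a two-sided derivative at every point of the set,
  which is too strong for an interval that contains one of its endpoints.
\<close>
definition cont_differentiable_on :: "(real \<Rightarrow> 'a::real_normed_vector) \<Rightarrow> real set \<Rightarrow> bool"
    (infix \<open>cont'_differentiable'_on\<close> 50) where
  "f cont_differentiable_on I \<longleftrightarrow>
     (\<exists>f'. (\<forall>t\<in>I. (f has_vector_derivative f' t) (at t within I)) \<and> continuous_on I f')"

text \<open>The bilinear dot product, without conjugation.\<close>
definition bdot :: "complex^'n \<Rightarrow> complex^'n \<Rightarrow> complex" (infixl \<open>\<cdot>\<close> 70) where
  "u \<cdot> v = (\<Sum>i\<in>UNIV. u $ i * v $ i)"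

text \<open>
  Scalar multiplication of matrices; \<open>c *s A\<close> is not available for this purpose, since it
  expects \<open>c\<close> to have the type of the rows of \<open>A\<close>.
\<close>
definition mscale :: "complex \<Rightarrow> complex^'m^'n \<Rightarrow> complex^'m^'n" (infixr \<open>*\<^sub>M\<close> 75) where
  "c *\<^sub>M A = (\<chi> i j. c * A $ i $ j)"

definition commutator :: "complex^'n^'n \<Rightarrow> complex^'n^'n \<Rightarrow> complex^'n^'n" where
  "commutator A A' = A ** A' - A' ** A"

definition adjoint_matrix :: "complex^'m^'n \<Rightarrow> complex^'n^'m" where
  "adjoint_matrix A = (\<chi> i j. cnj (A $ j $ i))"

definition diag :: "complex^'n \<Rightarrow> complex^'n^'n" where
  "diag u = (\<chi> i j. if i = j then u $ i else 0)"

definition pauli_dot :: "complex^3 \<Rightarrow> complex^2^2" where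
  "pauli_dot s =
     vector [vector [s $ 3, s $ 1 - \<i> * s $ 2],
             vector [s $ 1 + \<i> * s $ 2, - s $ 3]]"

definition H_mat :: "complex^2^2" where
  "H_mat = (\<chi> i j. 1)"

text \<open>
  The index set \<open>1, \<dots>, N\<close> is a finite type \<open>'n\<close>, and \<open>2N\<close>-dimensional objects are indexed by
  \<open>'n \<times> 2\<close>: the entry at \<open>((j, a), (k, b))\<close> is entry \<open>(a, b)\<close> of block \<open>(j, k)\<close>.
\<close>
definition block_diag :: "('n::finite \<Rightarrow> complex^2^2) \<Rightarrow> complex^('n \<times> 2)^('n \<times> 2)" where
  "block_diag D = (\<chi> p q. if fst p = fst q then D (fst p) $ snd p $ snd q else 0)"

definition T_col :: "complex^2^('n::finite \<times> 2)" where
  "T_col = (\<chi> p b. (mat 1 :: complex^2^2) $ snd p $ b)"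

definition doubled :: "complex^'n^'n \<Rightarrow> complex^('n::finite \<times> 2)^('n \<times> 2)" where
  "doubled U = (\<chi> p q. (U $ fst p $ fst q *\<^sub>M (mat 1 :: complex^2^2)) $ snd p $ snd q)"

end

theory Submission
  imports Defs
begin

text \<open>
  Everything rests on the factorization \<open>A\<^sub>j = e\<^sub>j \<xi>\<^sub>j\<^sup>T\<close>, which is what \<open>E\<^sub>j H F\<^sub>j\<close> amounts to because \<open>H\<close>
  is the all-ones matrix. Since \<open>\<xi>\<^sub>j\<close> is \<open>e\<^sub>j\<close> rotated by a right angle, \<open>\<xi>\<^sub>j \<cdot> e\<^sub>k\<close> is antisymmetric in
  \<open>j\<close> and \<open>k\<close>, so that
  \<open>[A\<^sub>j, A\<^sub>k] = (\<xi>\<^sub>j \<cdot> e\<^sub>k) (e\<^sub>j \<xi>\<^sub>k\<^sup>T + e\<^sub>k \<xi>\<^sub>j\<^sup>T)\<close>. Dividing by \<open>(x\<^sub>j - x\<^sub>k)\<^sup>2\<close> and summing over \<open>k\<close>, the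
  right-hand side of the spin equation becomes the product-rule expression for \<open>e\<^sub>j \<xi>\<^sub>j\<^sup>T\<close> in which the
  derivatives of \<open>e\<^sub>j\<close> and \<open>\<xi>\<^sub>j\<close> are replaced by the right-hand sides of the half-spin equations. Hence
  the half-spin equations imply the spin equations.

  Conversely, the spin equation prescribes the derivatives of \<open>\<alpha>\<^sup>2\<close>, \<open>\<beta>\<^sup>2\<close> and \<open>\<alpha>\<beta>\<close>. Where \<open>\<alpha> \<noteq> 0\<close> the
  first one determines \<open>\<alpha>'\<close>, and then the third determines \<open>\<beta>'\<close>; where \<open>\<beta> \<noteq> 0\<close> the second one
  determines \<open>\<beta>'\<close>, and then the third determines \<open>\<alpha>'\<close>. As \<open>s\<^sub>j \<noteq> 0\<close>, one of the two cases always applies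
  (\<open>square_derivatives_iff\<close>).

  For the last claim, the half-spin equations say that, for each fixed position \<open>(a, b)\<close>, the vector of
  the \<open>(a, b)\<close> entries of all \<open>E\<^sub>j\<close>, and likewise of all \<open>F\<^sub>j\<close>, solves \<open>y' = B y\<close>. The doubled matrix
  \<open>[U]\<close> acts on these vectors by \<open>U\<close>, and \<open>U y(0)\<close> solves the same equation with the same initial value.
  As \<open>B\<close> is continuous, a Gronwall estimate shows that the two solutions coincide
  (\<open>linear_ode_zero\<close>, \<open>linear_ode_propagator\<close>).
\<close>

section \<open>Derivatives of half-spins\<close>

lemma vector_derivative_vec_iff:
  fixes f :: "real \<Rightarrow> 'a::real_normed_vector^'n"
  shows "(f has_vector_derivative f') F \<longleftrightarrow>
    (\<forall>i. ((\<lambda>t. f t $ i) has_vector_derivative f' $ i) F)"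
proof
  assume "(f has_vector_derivative f') F"
  then show "\<forall>i. ((\<lambda>t. f t $ i) has_vector_derivative f' $ i) F"
    using bounded_linear.has_vector_derivative[OF bounded_linear_vec_nth] by blast
next
  assume "\<forall>i. ((\<lambda>t. f t $ i) has_vector_derivative f' $ i) F"
  then show "(f has_vector_derivative f') F"
    unfolding has_vector_derivative_def has_derivative_def
    by (auto intro!: vec_tendstoI bounded_linear_scaleR_left)
qed

text \<open>
  The interval may consist of a single point. The filter \<open>at t within I\<close> is then trivial, derivatives are
  not unique, and every differential equation on \<open>I\<close> holds for this reason.
\<close>
lemma vector_derivative_trivial_filter: "(f has_vector_derivative f') bot"
  by (simp add: has_vector_derivative_def has_derivative_def bounded_linear_scaleR_left)

lemma vector_derivative_diag_iff:
  "((\<lambda>t. diag (vector [f t, g t] :: complex^2)) has_vector_derivative diag (vector [p, q])) F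
    \<longleftrightarrow> (f has_vector_derivative p) F \<and> (g has_vector_derivative q) F"
  by (simp add: vector_derivative_vec_iff forall_2 diag_def vector_2)

text \<open>
  From right to left this is the product rule. In the other direction, the existence of the derivatives
  of \<open>\<alpha>\<close> and \<open>\<beta>\<close> is essential: the product rule then turns the prescribed derivatives into linear
  equations for them. At a zero of \<open>\<alpha>\<close> the equation for \<open>\<alpha>\<^sup>2\<close> says nothing about \<open>\<alpha>'\<close>; there the
  equation for \<open>\<alpha>\<beta>\<close> determines it, because \<open>\<beta> \<noteq> 0\<close>. The same holds with \<open>\<alpha>\<close> and \<open>\<beta>\<close> exchanged.
\<close>
lemma square_derivatives_iff:
  fixes \<alpha> \<beta> :: "real \<Rightarrow> complex"
  assumes "\<alpha> differentiable (at t within I)" "\<beta> differentiable (at t within I)"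
    and nz: "\<alpha> t \<noteq> 0 \<or> \<beta> t \<noteq> 0"
  shows "((\<lambda>t. (\<alpha> t)\<^sup>2) has_vector_derivative 2 * \<alpha> t * p) (at t within I) \<and>
         ((\<lambda>t. (\<beta> t)\<^sup>2) has_vector_derivative 2 * \<beta> t * q) (at t within I) \<and>
         ((\<lambda>t. \<alpha> t * \<beta> t) has_vector_derivative \<alpha> t * q + \<beta> t * p) (at t within I) \<longleftrightarrow>
         (\<alpha> has_vector_derivative p) (at t within I) \<and>
         (\<beta> has_vector_derivative q) (at t within I)"
    (is "?squares \<longleftrightarrow> ?roots")
proof (cases "at t within I = bot")
  case True
  then show ?thesis by (simp add: vector_derivative_trivial_filter)
next
  case False
  have squares: "((\<lambda>t. (\<alpha> t)\<^sup>2) has_vector_derivative 2 * \<alpha> t * p) (at t within I)"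
      "((\<lambda>t. (\<beta> t)\<^sup>2) has_vector_derivative 2 * \<beta> t * q) (at t within I)"
      "((\<lambda>t. \<alpha> t * \<beta> t) has_vector_derivative \<alpha> t * q + \<beta> t * p) (at t within I)"
    if "(\<alpha> has_vector_derivative p) (at t within I)"
       "(\<beta> has_vector_derivative q) (at t within I)" for p q
    using has_vector_derivative_mult[OF that(1) that(1)]
      has_vector_derivative_mult[OF that(2) that(2)]
      has_vector_derivative_mult[OF that(1) that(2)]
    by (simp_all add: power2_eq_square algebra_simps)
  show ?thesis
  proof
    assume ?squares
    obtain p' q' where roots: "(\<alpha> has_vector_derivative p') (at t within I)"
        "(\<beta> has_vector_derivative q') (at t within I)"
      using assms(1,2) by (auto simp: vector_derivative_works)
    note unique = vector_derivative_unique_within[OF False]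
    have "\<alpha> t * p' = \<alpha> t * p"
      using unique[OF squares(1)[OF roots], of "2 * \<alpha> t * p"] \<open>?squares\<close> by simp
    moreover have "\<beta> t * q' = \<beta> t * q"
      using unique[OF squares(2)[OF roots], of "2 * \<beta> t * q"] \<open>?squares\<close> by simp
    moreover have "\<alpha> t * q' + \<beta> t * p' = \<alpha> t * q + \<beta> t * p"
      using unique[OF squares(3)[OF roots]] \<open>?squares\<close> by blast
    ultimately have "p' = p \<and> q' = q"
      using nz by auto
    then show ?roots using roots by simp
  qed (use squares in blast)
qed

section \<open>Uniqueness for linear differential equations\<close>

text \<open>
  A Gronwall argument that runs in both directions of time. The bound makes the derivative of
  \<open>\<bar>w\<bar>\<^sup>2\<close> at most \<open>2 K \<bar>w\<bar>\<^sup>2\<close> in absolute value, so \<open>exp (-2 K t) \<bar>w\<bar>\<^sup>2\<close> decreases and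
  \<open>exp (2 K t) \<bar>w\<bar>\<^sup>2\<close> increases. The first function carries a zero at \<open>a\<close> to \<open>b\<close>, the second one a zero
  at \<open>b\<close> to \<open>a\<close>.
\<close>
lemma derivative_bound_imp_zero:
  fixes w :: "real \<Rightarrow> 'a::real_inner"
  assumes w': "\<And>t. t \<in> {a..b} \<Longrightarrow> (w has_vector_derivative w' t) (at t within {a..b})"
    and bound: "\<And>t. t \<in> {a..b} \<Longrightarrow> norm (w' t) \<le> K * norm (w t)"
    and zero: "w a = 0 \<or> w b = 0" and "a \<le> b"
  shows "w a = 0 \<and> w b = 0"
proof -
  define g where "g c t = exp (c * t) * (w t \<bullet> w t)" for c t
  define g' where "g' c t = exp (c * t) * (c * (w t \<bullet> w t) + 2 * (w t \<bullet> w' t))" for c t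
  have w_cont: "continuous_on {a..b} w"
    using w' by (meson continuous_on_eq_continuous_within has_vector_derivative_continuous)
  then have cont: "continuous_on {a..b} (g c)" for c
    unfolding g_def by (intro continuous_intros)
  have deriv: "(g c has_field_derivative g' c t) (at t)" if "a < t" "t < b" for c t
  proof -
    have "(w has_vector_derivative w' t) (at t)"
      using w'[of t] that by (simp add: at_within_Icc_at)
    then have "(w has_derivative (\<lambda>h. h *\<^sub>R w' t)) (at t)"
      by (simp add: has_vector_derivative_def)
    then have "((\<lambda>t. w t \<bullet> w t) has_derivative (\<lambda>h. h * (2 * (w t \<bullet> w' t)))) (at t)"
      by (auto intro!: derivative_eq_intros simp: inner_commute algebra_simps)
    then have "((\<lambda>t. w t \<bullet> w t) has_field_derivative 2 * (w t \<bullet> w' t)) (at t)"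
      by (simp add: has_field_derivative_def mult_commute_abs)
    then show ?thesis
      unfolding g_def g'_def by (auto intro!: derivative_eq_intros simp: algebra_simps)
  qed
  have inner_bound: "\<bar>2 * (w t \<bullet> w' t)\<bar> \<le> 2 * K * (w t \<bullet> w t)" if "a < t" "t < b" for t
  proof -
    have "\<bar>w t \<bullet> w' t\<bar> \<le> norm (w t) * norm (w' t)"
      by (rule Cauchy_Schwarz_ineq2)
    also have "\<dots> \<le> norm (w t) * (K * norm (w t))"
      using bound[of t] that by (intro mult_left_mono) auto
    also have "\<dots> = K * (w t \<bullet> w t)"
      by (simp add: power2_norm_eq_inner[symmetric] power2_eq_square)
    finally show ?thesis by (simp add: abs_mult)
  qed
  have "g (- (2 * K)) a \<ge> g (- (2 * K)) b"
  proof (rule DERIV_nonpos_imp_decreasing_open[OF \<open>a \<le> b\<close> _ cont])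
    fix t assume t: "a < t" "t < b"
    have "g' (- (2 * K)) t \<le> 0"
      using inner_bound[OF t] by (auto simp: g'_def mult_le_0_iff)
    then show "\<exists>y. (g (- (2 * K)) has_field_derivative y) (at t) \<and> y \<le> 0"
      using deriv[OF t] by blast
  qed
  moreover have "g (2 * K) a \<le> g (2 * K) b"
  proof (rule DERIV_nonneg_imp_increasing_open[OF \<open>a \<le> b\<close> _ cont])
    fix t assume t: "a < t" "t < b"
    have "g' (2 * K) t \<ge> 0"
      using inner_bound[OF t] by (auto simp: g'_def zero_le_mult_iff)
    then show "\<exists>y. (g (2 * K) has_field_derivative y) (at t) \<and> y \<ge> 0"
      using deriv[OF t] by blast
  qed
  ultimately show ?thesis
    using zero by (auto simp: g_def mult_le_0_iff dot_square_norm)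
qed

lemma norm_matrix_vector_mult_le:
  fixes A :: "complex^'n^'m"
  shows "norm (A *v w) \<le> (\<Sum>i\<in>UNIV. \<Sum>k\<in>UNIV. norm (A $ i $ k)) * norm w"
proof -
  have "norm (A *v w) \<le> (\<Sum>i\<in>UNIV. norm ((A *v w) $ i))"
    by (simp add: norm_vec_def L2_set_le_sum)
  also have "\<dots> \<le> (\<Sum>i\<in>UNIV. (\<Sum>k\<in>UNIV. norm (A $ i $ k)) * norm w)"
  proof (rule sum_mono)
    fix i
    have "norm ((A *v w) $ i) \<le> (\<Sum>k\<in>UNIV. norm (A $ i $ k * w $ k))"
      by (simp add: matrix_vector_mult_def norm_sum)
    also have "\<dots> \<le> (\<Sum>k\<in>UNIV. norm (A $ i $ k) * norm w)"
      by (intro sum_mono) (simp add: norm_mult mult_left_mono Finite_Cartesian_Product.norm_nth_le)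
    finally show "norm ((A *v w) $ i) \<le> (\<Sum>k\<in>UNIV. norm (A $ i $ k)) * norm w"
      by (simp add: sum_distrib_right)
  qed
  finally show ?thesis by (simp add: sum_distrib_right)
qed

text \<open>
  The interval need not be compact and \<open>B\<close> may be unbounded on it. The Gronwall estimate is therefore
  used on the compact interval between \<open>t0\<close> and \<open>t\<close>, with \<open>t\<close> on either side of \<open>t0\<close>.
\<close>
lemma linear_ode_zero:
  fixes B :: "real \<Rightarrow> complex^'n^'n" and w :: "real \<Rightarrow> complex^'n"
  assumes I: "is_interval I" "t0 \<in> I" "t \<in> I"
    and B: "continuous_on I B"
    and w': "\<And>t. t \<in> I \<Longrightarrow> (w has_vector_derivative B t *v w t) (at t within I)"
    and zero: "w t0 = 0"
  shows "w t = 0"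
proof -
  define a b where "a = min t0 t" and "b = max t0 t"
  have ab: "a \<le> b" "a \<in> I" "b \<in> I" "t0 \<in> {a, b}" "t \<in> {a, b}"
    using I by (auto simp: a_def b_def min_def max_def)
  then have sub: "{a..b} \<subseteq> I"
    by (meson I(1) atLeastAtMost_iff mem_is_interval_1_I subsetI)
  define k where "k t = (\<Sum>i\<in>UNIV. \<Sum>j\<in>UNIV. norm (B t $ i $ j))" for t
  have "continuous_on {a..b} k"
    unfolding k_def using continuous_on_subset[OF B sub] by (intro continuous_intros)
  then have "bounded (k ` {a..b})"
    by (intro compact_imp_bounded compact_continuous_image) auto
  then obtain K where K: "\<And>s. s \<in> {a..b} \<Longrightarrow> k s \<le> K"
    unfolding bounded_iff real_norm_def by (blast intro: abs_le_D1)
  have "w a = 0 \<and> w b = 0"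
  proof (rule derivative_bound_imp_zero)
    fix s assume s: "s \<in> {a..b}"
    show "(w has_vector_derivative B s *v w s) (at s within {a..b})"
      using has_vector_derivative_within_subset[OF w' sub] sub s by blast
    have "norm (B s *v w s) \<le> k s * norm (w s)"
      unfolding k_def by (rule norm_matrix_vector_mult_le)
    also have "\<dots> \<le> K * norm (w s)"
      using K[OF s] by (rule mult_right_mono) simp
    finally show "norm (B s *v w s) \<le> K * norm (w s)" .
  qed (use ab zero in auto)
  then show ?thesis using ab by auto
qed

text \<open>
  The difference of the two sides solves the homogeneous equation and vanishes at \<open>t0\<close>.
\<close>
lemma linear_ode_propagator:
  fixes B U :: "real \<Rightarrow> complex^'n^'n" and y :: "real \<Rightarrow> complex^'n"
  assumes I: "is_interval I" "t0 \<in> I" "t \<in> I"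
    and B: "continuous_on I B"
    and y': "\<And>t. t \<in> I \<Longrightarrow> (y has_vector_derivative B t *v y t) (at t within I)"
    and U': "\<And>t. t \<in> I \<Longrightarrow> (U has_vector_derivative B t ** U t) (at t within I)"
    and U0: "U t0 = mat 1"
  shows "y t = U t *v y t0"
proof -
  have "((\<lambda>t. U t *v y t0) has_vector_derivative B t *v (U t *v y t0)) (at t within I)"
    if "t \<in> I" for t
  proof -
    have "((\<lambda>t. U t $ i $ k) has_vector_derivative (B t ** U t) $ i $ k) (at t within I)" for i k
      using U'[OF that] by (simp add: vector_derivative_vec_iff)
    then have "((\<lambda>t. \<Sum>k\<in>UNIV. U t $ i $ k * y t0 $ k) has_vector_derivative
        (\<Sum>k\<in>UNIV. (B t ** U t) $ i $ k * y t0 $ k)) (at t within I)" for i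
      by (intro has_vector_derivative_sum has_vector_derivative_mult_left)
    then show ?thesis
      by (simp add: vector_derivative_vec_iff matrix_vector_mul_assoc)
        (simp add: matrix_vector_mult_def)
  qed
  then have "((\<lambda>t. y t - U t *v y t0) has_vector_derivative B t *v (y t - U t *v y t0)) (at t within I)"
    if "t \<in> I" for t
    unfolding matrix_vector_mult_diff_distrib
    using that by (intro has_vector_derivative_diff y')
  then have "y t - U t *v y t0 = 0"
    by (rule linear_ode_zero[OF I B]) (auto simp: U0)
  then show ?thesis by simp
qed

section \<open>Block columns\<close>

lemma matrix_mult_block_entry:
  fixes X :: "'a::semiring_1^('n::finite \<times> 'b::finite)^'m" and V :: "'a^'c^('n \<times> 'b)"
  shows "(X ** V) $ p $ b = (\<Sum>k\<in>UNIV. \<Sum>c\<in>UNIV. X $ p $ (k, c) * V $ (k, c) $ b)"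
  by (simp add: matrix_matrix_mult_def sum.cartesian_product)

text \<open>
  Doubling replaces each scalar by a multiple of the identity block, so it mixes the blocks of a block
  column but never the positions inside a block.
\<close>
lemma doubled_mult_entry:
  fixes V :: "complex^2^('n::finite \<times> 2)"
  shows "(doubled U ** V) $ (j, a) $ b = (U *v (\<chi> k. V $ (k, a) $ b)) $ j"
proof -
  have "doubled U $ (j, a) $ (k, c) * V $ (k, c) $ b =
      (if a = c then U $ j $ k * V $ (k, a) $ b else 0)" for k c
    by (simp add: doubled_def mscale_def mat_def)
  then show ?thesis
    by (simp add: matrix_mult_block_entry matrix_vector_mult_def)
qed

lemma block_diag_mult_T_entry: "(block_diag D ** T_col) $ (j, a) $ b = D j $ a $ b"
proof -
  have "block_diag D $ (j, a) $ (k, c) * T_col $ (k, c) $ b =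
      (if c = b then if j = k then D j $ a $ b else 0 else 0)" for k c
    by (simp add: block_diag_def T_col_def mat_def)
  then show ?thesis
    by (simp add: matrix_mult_block_entry)
qed

text \<open>
  Reading off one position \<open>(a, b)\<close> of all blocks at once turns the coupled matrix equations for the
  \<open>D j\<close> into independent copies of the vector equation \<open>y' = B y\<close>. The propagator of this equation,
  applied to every position, is the doubled matrix.
\<close>
lemma block_column_propagator:
  fixes B U :: "real \<Rightarrow> complex^'n^'n" and D :: "'n::finite \<Rightarrow> real \<Rightarrow> complex^2^2"
  assumes I: "is_interval I" "t0 \<in> I" "t \<in> I"
    and B: "continuous_on I B"
    and D': "\<And>j t. t \<in> I \<Longrightarrow>
      (D j has_vector_derivative (\<Sum>l\<in>UNIV. (B t $ j $ l) *\<^sub>M D l t)) (at t within I)"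
    and U': "\<And>t. t \<in> I \<Longrightarrow> (U has_vector_derivative B t ** U t) (at t within I)"
    and U0: "U t0 = mat 1"
  shows "block_diag (\<lambda>j. D j t) ** T_col = doubled (U t) ** block_diag (\<lambda>j. D j t0) ** T_col"
proof -
  have "D j t $ a $ b = (U t *v (\<chi> k. D k t0 $ a $ b)) $ j" for j a b
  proof -
    have "((\<lambda>t. \<chi> k. D k t $ a $ b) has_vector_derivative
        B t *v (\<chi> k. D k t $ a $ b)) (at t within I)" if "t \<in> I" for t
      using D'[OF that]
      by (simp add: vector_derivative_vec_iff matrix_vector_mult_def mscale_def)
    from linear_ode_propagator[OF I B this U' U0] show ?thesis
      by (metis vec_lambda_beta)
  qed
  then show ?thesis
    by (simp add: vec_eq_iff matrix_mul_assoc[symmetric] doubled_mult_entry block_diag_mult_T_entry)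
qed

section \<open>Equivalence of the spin and half-spin equations\<close>

theorem lemma2p1:
  fixes I :: "real set"
    and M0 :: "complex^2^2"
    and M :: "real \<Rightarrow> complex \<Rightarrow> complex^2^2"
    and s :: "'n::finite \<Rightarrow> real \<Rightarrow> complex^3"
    and x :: "'n \<Rightarrow> real \<Rightarrow> complex"
    and \<alpha> \<beta> :: "'n \<Rightarrow> real \<Rightarrow> complex"
    and e \<xi> :: "'n \<Rightarrow> real \<Rightarrow> complex^2"
    and A E F :: "'n \<Rightarrow> real \<Rightarrow> complex^2^2"
    and B :: "real \<Rightarrow> complex^'n^'n"
  assumes I: "is_interval I" "0 \<in> I"
    and A: "\<And>j t. A j t = pauli_dot (s j t)"
    and M: "\<And>t z. t \<in> I \<Longrightarrow> (\<forall>j. z \<noteq> x j t \<and> z \<noteq> cnj (x j t)) \<Longrightarrow>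
              M t z = M0 + (\<Sum>j\<in>UNIV. (1 / (z - x j t)) *\<^sub>M A j t)
                         + (\<Sum>j\<in>UNIV. (1 / (z - cnj (x j t))) *\<^sub>M adjoint_matrix (A j t))"
    and s_C1: "\<And>j. s j cont_differentiable_on I"
    and x_C1: "\<And>j. x j cont_differentiable_on I"
    and s_nonzero: "\<And>j t. t \<in> I \<Longrightarrow> s j t \<noteq> 0"
    and A_square: "\<And>j t. t \<in> I \<Longrightarrow> A j t ** A j t = 0"
    and x_distinct: "\<And>j k t. t \<in> I \<Longrightarrow> j \<noteq> k \<Longrightarrow> x j t \<noteq> x k t"
    and x_upper: "\<And>j t. t \<in> I \<Longrightarrow> Im (x j t) > 0"
    and \<alpha>_sqrt: "\<And>j t. t \<in> I \<Longrightarrow> (\<alpha> j t)\<^sup>2 = - s j t $ 1 + \<i> * s j t $ 2"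
    and \<beta>_sqrt: "\<And>j t. t \<in> I \<Longrightarrow> (\<beta> j t)\<^sup>2 = s j t $ 1 + \<i> * s j t $ 2"
    and \<alpha>\<beta>: "\<And>j t. t \<in> I \<Longrightarrow> \<alpha> j t * \<beta> j t = s j t $ 3"
    and \<alpha>_diff: "\<And>j. \<alpha> j differentiable_on I"
    and \<beta>_diff: "\<And>j. \<beta> j differentiable_on I"
    and e: "\<And>j t. e j t = vector [\<alpha> j t, \<beta> j t]"
    and \<xi>: "\<And>j t. \<xi> j t = vector [\<beta> j t, - \<alpha> j t]"
    and E: "\<And>j t. E j t = diag (e j t)"
    and F: "\<And>j t. F j t = diag (\<xi> j t)"
    and B: "\<And>t. B t = (\<chi> j k. if j = k then 0 else (\<xi> j t \<cdot> e k t) / (x j t - x k t)\<^sup>2)"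
  defines "spin_eqs \<equiv>
      (\<forall>j. \<forall>t\<in>I. (A j has_vector_derivative
          (\<Sum>k\<in>UNIV - {j}. (1 / (x j t - x k t)\<^sup>2) *\<^sub>M commutator (A j t) (A k t)))
          (at t within I))"
    and "half_spin_eqs \<equiv>
      (\<forall>j. \<forall>t\<in>I.
          (E j has_vector_derivative
            (\<Sum>l\<in>UNIV - {j}. ((\<xi> j t \<cdot> e l t) / (x j t - x l t)\<^sup>2) *\<^sub>M E l t)) (at t within I) \<and>
          (F j has_vector_derivative
            (\<Sum>l\<in>UNIV - {j}. ((\<xi> j t \<cdot> e l t) / (x j t - x l t)\<^sup>2) *\<^sub>M F l t)) (at t within I))"
  shows "(\<forall>j. \<forall>t\<in>I. A j t = E j t ** H_mat ** F j t) \<and>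
         (spin_eqs \<longleftrightarrow> half_spin_eqs) \<and>
         (half_spin_eqs \<longrightarrow>
           (\<forall>U :: real \<Rightarrow> complex^'n^'n.
              (\<forall>t\<in>I. (U has_vector_derivative B t ** U t) (at t within I)) \<and> U 0 = mat 1 \<longrightarrow>
              (\<forall>t\<in>I.
                 block_diag (\<lambda>j. E j t) ** T_col = doubled (U t) ** block_diag (\<lambda>j. E j 0) ** T_col \<and>
                 block_diag (\<lambda>j. F j t) ** T_col = doubled (U t) ** block_diag (\<lambda>j. F j 0) ** T_col)))"
proof -
  \<comment> \<open>\<open>p\<close> and \<open>q\<close> are the derivatives of \<open>\<alpha>\<close> and \<open>\<beta>\<close> that the half-spin equations demand.\<close>
  define c where "c j l t = (\<xi> j t \<cdot> e l t) / (x j t - x l t)\<^sup>2" for j l t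
  define p where "p j t = (\<Sum>l\<in>UNIV - {j}. c j l t * \<alpha> l t)" for j t
  define q where "q j t = (\<Sum>l\<in>UNIV - {j}. c j l t * \<beta> l t)" for j t

  have A_entries: "A j t = vector [vector [\<alpha> j t * \<beta> j t, - (\<alpha> j t)\<^sup>2],
      vector [(\<beta> j t)\<^sup>2, - (\<alpha> j t * \<beta> j t)]]" if "t \<in> I" for j t
    using that by (simp add: A pauli_dot_def \<alpha>_sqrt \<beta>_sqrt \<alpha>\<beta>)
  have EHF: "A j t = E j t ** H_mat ** F j t" if "t \<in> I" for j t
    using that
    by (simp add: A_entries E F e \<xi> vec_eq_iff forall_2 matrix_matrix_mult_def diag_def H_mat_def
        UNIV_2 power2_eq_square)

  have nonzero: "\<alpha> j t \<noteq> 0 \<or> \<beta> j t \<noteq> 0" if "t \<in> I" for j t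
  proof (rule ccontr)
    assume "\<not> ?thesis"
    then have "s j t $ 1 = 0" "s j t $ 2 = 0" "s j t $ 3 = 0"
      using \<alpha>_sqrt[OF that, of j] \<beta>_sqrt[OF that, of j] \<alpha>\<beta>[OF that, of j]
      by (auto simp: algebra_simps add_eq_0_iff)
    then show False
      using s_nonzero[OF that, of j] by (simp add: vec_eq_iff forall_3)
  qed

  have spin_rhs: "(\<Sum>k\<in>UNIV - {j}. (1 / (x j t - x k t)\<^sup>2) *\<^sub>M commutator (A j t) (A k t)) =
      vector [vector [\<alpha> j t * q j t + \<beta> j t * p j t, - (2 * \<alpha> j t * p j t)],
        vector [2 * \<beta> j t * q j t, - (\<alpha> j t * q j t + \<beta> j t * p j t)]]" if "t \<in> I" for j t
  proof -
    \<comment> \<open>The entries of \<open>(\<xi>\<^sub>j \<cdot> e\<^sub>k) (e\<^sub>j \<xi>\<^sub>k\<^sup>T + e\<^sub>k \<xi>\<^sub>j\<^sup>T) / (x\<^sub>j - x\<^sub>k)\<^sup>2\<close>. For \<open>k = j\<close> both sides vanish,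
      whatever value the quotient has.\<close>
    have comm: "(1 / (x j t - x k t)\<^sup>2) *\<^sub>M commutator (A j t) (A k t) = c j k t *\<^sub>M
        vector [vector [\<alpha> j t * \<beta> k t + \<beta> j t * \<alpha> k t, - (2 * \<alpha> j t * \<alpha> k t)],
          vector [2 * \<beta> j t * \<beta> k t, - (\<alpha> j t * \<beta> k t + \<beta> j t * \<alpha> k t)]]" for k
      by (simp add: A_entries[OF that] c_def mscale_def commutator_def bdot_def e \<xi> vec_eq_iff
          forall_2 matrix_matrix_mult_def UNIV_2 divide_simps)
        (simp add: algebra_simps power2_eq_square)
    show ?thesis
      unfolding comm
      by (simp add: vec_eq_iff forall_2 mscale_def p_def q_def sum_distrib_left sum.distrib
          sum_negf sum_subtractf algebra_simps)
  qed
  have spin_iff: "(A j has_vector_derivative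
      (\<Sum>k\<in>UNIV - {j}. (1 / (x j t - x k t)\<^sup>2) *\<^sub>M commutator (A j t) (A k t))) (at t within I)
    \<longleftrightarrow> (\<alpha> j has_vector_derivative p j t) (at t within I) \<and>
        (\<beta> j has_vector_derivative q j t) (at t within I)" if "t \<in> I" for j t
  proof -
    let ?G = "\<lambda>t. vector [vector [\<alpha> j t * \<beta> j t, - (\<alpha> j t)\<^sup>2],
      vector [(\<beta> j t)\<^sup>2, - (\<alpha> j t * \<beta> j t)]] :: complex^2^2"
    have neg: "((\<lambda>t. - f t) has_vector_derivative - f') (at t within I)
      \<longleftrightarrow> (f has_vector_derivative f') (at t within I)" for f :: "real \<Rightarrow> complex" and f'
      using has_vector_derivative_minus[of f f' "at t within I"]
        has_vector_derivative_minus[of "\<lambda>t. - f t" "- f'" "at t within I"] by auto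
    \<comment> \<open>The half-spins are square roots of the spins only on \<open>I\<close>, which suffices for derivatives within \<open>I\<close>.\<close>
    have transfer: "(A j has_vector_derivative D) (at t within I) \<longleftrightarrow>
        (?G has_vector_derivative D) (at t within I)" for D
      using has_vector_derivative_transform[OF that, of "A j" ?G D]
        has_vector_derivative_transform[OF that, of ?G "A j" D] A_entries by auto
    have entries: "(?G has_vector_derivative
        (\<Sum>k\<in>UNIV - {j}. (1 / (x j t - x k t)\<^sup>2) *\<^sub>M commutator (A j t) (A k t))) (at t within I)
      \<longleftrightarrow> ((\<lambda>t. (\<alpha> j t)\<^sup>2) has_vector_derivative 2 * \<alpha> j t * p j t) (at t within I) \<and>
         ((\<lambda>t. (\<beta> j t)\<^sup>2) has_vector_derivative 2 * \<beta> j t * q j t) (at t within I) \<and>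
         ((\<lambda>t. \<alpha> j t * \<beta> j t) has_vector_derivative
            \<alpha> j t * q j t + \<beta> j t * p j t) (at t within I)"
      unfolding spin_rhs[OF that] vector_derivative_vec_iff forall_2 vector_2 neg by blast
    have diff: "\<alpha> j differentiable (at t within I)" "\<beta> j differentiable (at t within I)"
      using \<alpha>_diff \<beta>_diff that by (auto simp: differentiable_on_def)
    show ?thesis
      unfolding transfer entries by (rule square_derivatives_iff[OF diff nonzero[OF that]])
  qed

  have E_rhs: "(\<Sum>l\<in>UNIV - {j}. c j l t *\<^sub>M E l t) = diag (vector [p j t, q j t])"
    and F_rhs: "(\<Sum>l\<in>UNIV - {j}. c j l t *\<^sub>M F l t) = diag (vector [q j t, - p j t])" for j t
    by (simp_all add: E F e \<xi> vec_eq_iff forall_2 mscale_def diag_def p_def q_def sum_negf)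
  have E_fun: "E j = (\<lambda>t. diag (vector [\<alpha> j t, \<beta> j t]))"
    and F_fun: "F j = (\<lambda>t. diag (vector [\<beta> j t, - \<alpha> j t]))" for j
    by (auto simp: E F e \<xi>)
  have half_iff: "(E j has_vector_derivative (\<Sum>l\<in>UNIV - {j}. c j l t *\<^sub>M E l t)) (at t within I) \<and>
      (F j has_vector_derivative (\<Sum>l\<in>UNIV - {j}. c j l t *\<^sub>M F l t)) (at t within I)
    \<longleftrightarrow> (\<alpha> j has_vector_derivative p j t) (at t within I) \<and>
        (\<beta> j has_vector_derivative q j t) (at t within I)" for j t
    unfolding E_rhs F_rhs
    unfolding E_fun F_fun vector_derivative_diag_iff
    using has_vector_derivative_minus[of "\<alpha> j" "p j t" "at t within I"] by blast
  have equiv: "spin_eqs \<longleftrightarrow> half_spin_eqs"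
    unfolding spin_eqs_def half_spin_eqs_def c_def[symmetric] half_iff using spin_iff by blast

  have cont_\<alpha>: "continuous_on I (\<alpha> j)" and cont_\<beta>: "continuous_on I (\<beta> j)" for j
    using \<alpha>_diff \<beta>_diff by (auto intro: differentiable_imp_continuous_on)
  have cont_x: "continuous_on I (x j)" for j
    using x_C1[of j] unfolding cont_differentiable_on_def
    by (meson continuous_on_eq_continuous_within has_vector_derivative_continuous)
  have cont_B: "continuous_on I B"
  proof -
    have "continuous_on I (\<lambda>t. if j = k then 0 else (\<xi> j t \<cdot> e k t) / (x j t - x k t)\<^sup>2)" for j k
      using x_distinct
      by (cases "j = k")
        (auto simp: bdot_def e \<xi> UNIV_2 intro!: continuous_intros cont_\<alpha> cont_\<beta> cont_x)
    then show ?thesis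
      unfolding B by (intro continuous_on_vec_lambda)
  qed

  \<comment> \<open>The half-spin equations omit the term \<open>l = j\<close>, whereas the product with \<open>B\<close> includes it with
    coefficient zero.\<close>
  have B_sum: "(\<Sum>l\<in>UNIV. (B t $ j $ l) *\<^sub>M D l) = (\<Sum>l\<in>UNIV - {j}. c j l t *\<^sub>M D l)"
    for t j and D :: "'n \<Rightarrow> complex^2^2"
  proof -
    have "(\<Sum>l\<in>UNIV. (B t $ j $ l) *\<^sub>M D l) = (\<Sum>l\<in>UNIV - {j}. (B t $ j $ l) *\<^sub>M D l)"
      by (intro sum.mono_neutral_right) (auto simp: B mscale_def vec_eq_iff)
    also have "\<dots> = (\<Sum>l\<in>UNIV - {j}. c j l t *\<^sub>M D l)"
      by (intro sum.cong) (auto simp: B c_def)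
    finally show ?thesis .
  qed
  have propagate:
    "block_diag (\<lambda>j. E j t) ** T_col = doubled (U t) ** block_diag (\<lambda>j. E j 0) ** T_col \<and>
     block_diag (\<lambda>j. F j t) ** T_col = doubled (U t) ** block_diag (\<lambda>j. F j 0) ** T_col"
    if half_spin_eqs and "\<forall>t\<in>I. (U has_vector_derivative B t ** U t) (at t within I)"
      and "U 0 = mat 1" and "t \<in> I" for U t
    using that
    by (intro conjI block_column_propagator[OF I _ cont_B])
      (auto simp: half_spin_eqs_def c_def[symmetric] B_sum)

  show ?thesis
    using EHF equiv propagate by blast
qed

end
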